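(* Let $\Gamma_1>\Gamma_2>0$ and $C\in\mathbb{R}$. For real $x$ and $y_1$, put $y_2=\frac{C}{\Gamma_2}-\frac{\Gamma_1}{\Gamma_2}y_1$ and let $$\mathcal{H}(x,y_1)= -\frac{\Gamma_1\Gamma_2}{2\pi}\log\left|\theta_1\left(\frac{x+i(y_1-y_2)}{2},e^{-\frac{\pi}{2}}\right)\right| + \frac{\Gamma_1\Gamma_2}{2\pi}\log\left|\theta_2\left(\frac{x+i(y_1+y_2)}{2},e^{-\frac{\pi}{2}}\right)\right| - \frac{\Gamma_1\Gamma_2}{\pi^2}y_1y_2 + \sum_{j=1}^{2}\frac{\Gamma_j^2}{4\pi}\left(\log\left|\theta_1\left(iy_j - \frac{\pi}{2},e^{-\frac{\pi}{2}}\right)\right| - \frac{2y_j^2}{\pi}\right)$$ be the reduced Hamiltonian. Then the only singular points of $\mathcal{H}$ on the line $x=0$ are the points with $$y_1=\frac{\pi k\Gamma_2+C}{\Gamma_1+\Gamma_2},\qquad k\in\mathbb{Z},$$ and the only singular points of $\mathcal{H}$ on the lines $x=\pm\pi$ are the points with $$y_1=\frac{k\pi\Gamma_2-C}{\Gamma_2-\Gamma_1},\qquad k\in\mathbb{Z}.$$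
   Context: $\theta_1,\theta_2$ are the Jacobi theta functions, given for $z\in\mathbb{C}$ and real $0<q<1$ by $\theta_1(z,q)=2\sum_{n=0}^{\infty}(-1)^n q^{(n+1/2)^2}\sin((2n+1)z)$ and $\theta_2(z,q)=2\sum_{n=0}^{\infty} q^{(n+1/2)^2}\cos((2n+1)z)$. The function $\mathcal{H}(x,y_1)$ is the Hamiltonian of two point vortices on the Klein bottle with strengths $\Gamma_1,\Gamma_2$ at $z_1=x_1+iy_1$, $z_2=x_2+iy_2$, which depends on $x_1,x_2$ only through $x=x_1-x_2$, after elimination of $y_2$ through the conserved quantity $C=\Gamma_1y_1+\Gamma_2y_2$; here $y_1$ ranges over all of $\mathbb{R}$. A singular point is a point $(x,y_1)$ at which one of the logarithms in $\mathcal{H}$ has argument zero, so that $\mathcal{H}$ is undefined. *)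

theory Defs
  imports "HOL-Complex_Analysis.Complex_Analysis" "HOL-Library.Monad_Syntax"
begin

text \<open>Jacobi theta functions with a real nome \<open>q\<close>; the series converge for every complex \<open>z\<close>
  when \<open>0 < q < 1\<close>, and are only meaningful there.\<close>

definition theta1 :: "complex \<Rightarrow> real \<Rightarrow> complex" where
  "theta1 z q =
     2 * (\<Sum>n. (-1) ^ n * of_real (q powr ((real n + 1/2)\<^sup>2)) * sin (of_nat (2 * n + 1) * z))"

definition theta2 :: "complex \<Rightarrow> real \<Rightarrow> complex" where
  "theta2 z q =
     2 * (\<Sum>n. of_real (q powr ((real n + 1/2)\<^sup>2)) * cos (of_nat (2 * n + 1) * z))"

text \<open>The logarithm of an absolute value as a partial function. The library's total \<open>ln\<close>
  satisfies \<open>ln 0 = 0\<close>, which would hide the singularities.\<close>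

definition log_abs :: "complex \<Rightarrow> real option" where
  "log_abs w = (if w = 0 then None else Some (ln (cmod w)))"

definition vortex_y2 :: "real \<Rightarrow> real \<Rightarrow> real \<Rightarrow> real \<Rightarrow> real" where
  "vortex_y2 \<Gamma>1 \<Gamma>2 C y1 = C / \<Gamma>2 - \<Gamma>1 / \<Gamma>2 * y1"

text \<open>The value is \<open>None\<close> as soon as one of the four logarithms has argument zero;
  see \<open>singular_points_iff\<close> below.\<close>

definition reduced_hamiltonian ::
  "real \<Rightarrow> real \<Rightarrow> real \<Rightarrow> real \<Rightarrow> real \<Rightarrow> real option" where
  "reduced_hamiltonian \<Gamma>1 \<Gamma>2 C x y1 =
    (let q = exp (- pi / 2); y2 = vortex_y2 \<Gamma>1 \<Gamma>2 C y1 in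
     do {
       l1 \<leftarrow> log_abs (theta1 ((of_real x + \<i> * of_real (y1 - y2)) / 2) q);
       l2 \<leftarrow> log_abs (theta2 ((of_real x + \<i> * of_real (y1 + y2)) / 2) q);
       s1 \<leftarrow> log_abs (theta1 (\<i> * of_real y1 - of_real (pi / 2)) q);
       s2 \<leftarrow> log_abs (theta1 (\<i> * of_real y2 - of_real (pi / 2)) q);
       Some (- (\<Gamma>1 * \<Gamma>2 / (2 * pi)) * l1 + \<Gamma>1 * \<Gamma>2 / (2 * pi) * l2
             - \<Gamma>1 * \<Gamma>2 / pi\<^sup>2 * y1 * y2
             + (\<Gamma>1\<^sup>2 / (4 * pi) * (s1 - 2 * y1\<^sup>2 / pi)
                + \<Gamma>2\<^sup>2 / (4 * pi) * (s2 - 2 * y2\<^sup>2 / pi)))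
     })"

definition singular_points :: "real \<Rightarrow> real \<Rightarrow> real \<Rightarrow> (real \<times> real) set" where
  "singular_points \<Gamma>1 \<Gamma>2 C = {(x, y1). reduced_hamiltonian \<Gamma>1 \<Gamma>2 C x y1 = None}"

lemma singular_points_iff:
  fixes \<Gamma>1 \<Gamma>2 C x y1 :: real
  defines "q \<equiv> exp (- pi / 2)" and "y2 \<equiv> vortex_y2 \<Gamma>1 \<Gamma>2 C y1"
  shows "(x, y1) \<in> singular_points \<Gamma>1 \<Gamma>2 C \<longleftrightarrow>
    theta1 ((of_real x + \<i> * of_real (y1 - y2)) / 2) q = 0 \<or>
    theta2 ((of_real x + \<i> * of_real (y1 + y2)) / 2) q = 0 \<or>
    theta1 (\<i> * of_real y1 - of_real (pi / 2)) q = 0 \<or>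
    theta1 (\<i> * of_real y2 - of_real (pi / 2)) q = 0"
  unfolding singular_points_def reduced_hamiltonian_def q_def y2_def Let_def log_abs_def
  by (auto split: if_splits)

end

theory Submission
  imports Defs
begin

text \<open>
  Write \<open>q = exp (- a)\<close>. Completing the square in the series of \<open>\<theta>\<^sub>1(\<i> a s, q)\<close> gives
  \<open>\<i> exp (a s\<^sup>2)\<close> times an alternating sum of Gaussians \<open>exp (- a u\<^sup>2)\<close> over the half-integers
  shifted by \<open>s\<close>. This sum is odd and changes sign under \<open>s \<mapsto> s + 1\<close>, so it vanishes at all
  integers and it suffices to study \<open>0 < s \<le> 1/2\<close>. There, for \<open>a \<ge> 1\<close>, the terms decrease
  strictly and the alternating series is positive. Hence the zeros of \<open>\<theta>\<^sub>1\<close> on the imaginary axis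
  are exactly the integer multiples of \<open>\<i> a\<close>. Since \<open>\<theta>\<^sub>2\<close> is positive on the imaginary axis, and
  shifts by \<open>\<pi>/2\<close> exchange \<open>\<theta>\<^sub>1\<close> and \<open>\<theta>\<^sub>2\<close> up to sign, at each of \<open>x = 0\<close> and \<open>x = \<plusminus>\<pi>\<close> exactly one
  of the four logarithms can become singular.
\<close>

section \<open>Alternating Gaussian sums: convergence, oddness and sign change under unit
  shifts\<close>

definition gauss :: "real \<Rightarrow> real \<Rightarrow> nat \<Rightarrow> real" where
  "gauss a s n = exp (- a * (real n + 1/2 + s)\<^sup>2)"

lemma summable_gauss:
  assumes "a > 0"
  shows "summable (gauss a s)"
proof (rule summable_comparison_test')
  show "summable (\<lambda>n. exp (- a * (1/4 + s)) * exp (- a) ^ n)"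
    using assms by (intro summable_mult summable_geometric) auto
  fix n :: nat
  \<comment> \<open>The square (n + 1/2 + s)^2 equals (n + s)^2 + (n + s) + 1/4, so dropping (n +
    s)^2 leaves an exponent linear in n and hence a geometric majorant.\<close>
  have "0 \<le> (real n + s)\<^sup>2"
    by simp
  then have "real n + 1/4 + s \<le> (real n + 1/2 + s)\<^sup>2"
    by (simp add: power2_eq_square algebra_simps)
  then have "a * (real n + 1/4 + s) \<le> a * (real n + 1/2 + s)\<^sup>2"
    using assms by (intro mult_left_mono) auto
  then have "gauss a s n \<le> exp (- a * (1/4 + s) + real n * (- a))"
    unfolding gauss_def by (simp add: algebra_simps)
  also have "\<dots> = exp (- a * (1/4 + s)) * exp (- a) ^ n"
    by (simp only: exp_add exp_of_nat_mult)
  finally show "norm (gauss a s n) \<le> exp (- a * (1/4 + s)) * exp (- a) ^ n"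
    by (simp add: gauss_def)
qed

definition alt_gauss_sum :: "real \<Rightarrow> real \<Rightarrow> real" where
  "alt_gauss_sum a s = (\<Sum>n. (-1) ^ n * gauss a s n)"

lemma summable_alt_gauss:
  assumes "a > 0"
  shows "summable (\<lambda>n. (-1) ^ n * gauss a s n)"
  by (rule summable_comparison_test'[OF summable_gauss[OF assms, of s]])
     (simp add: abs_mult power_abs gauss_def)

lemma alt_gauss_sum_shift:
  assumes "a > 0"
  shows "alt_gauss_sum a (s + 1) = exp (- a * (1/2 + s)\<^sup>2) - alt_gauss_sum a s"
proof -
  have "gauss a (s + 1) n = gauss a s (Suc n)" for n
    by (simp add: gauss_def algebra_simps)
  then have "alt_gauss_sum a (s + 1) = - (\<Sum>n. (-1) ^ Suc n * gauss a s (Suc n))"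
    unfolding alt_gauss_sum_def using summable_alt_gauss[OF assms, of "s + 1"]
    by (simp add: suminf_minus)
  also have "\<dots> = gauss a s 0 - alt_gauss_sum a s"
    unfolding alt_gauss_sum_def
    using suminf_split_head[OF summable_alt_gauss[OF assms, of s]] by simp
  finally show ?thesis
    by (simp add: gauss_def)
qed

text \<open>This is the two-sided sum of (-1)^m exp(-a (m + 1/2 - s)^2) over all integers m, folded
  into one-sided sums: the indices m = -n - 1 contribute the terms of
  \<open>alt_gauss_sum a s\<close> with a minus sign.\<close>

definition odd_gauss_sum :: "real \<Rightarrow> real \<Rightarrow> real" where
  "odd_gauss_sum a s = alt_gauss_sum a (- s) - alt_gauss_sum a s"

lemma odd_gauss_sum_minus: "odd_gauss_sum a (- s) = - odd_gauss_sum a s"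
  by (simp add: odd_gauss_sum_def)

text \<open>Shifting both one-sided sums by one index splits off the head terms at s and at -s - 1.
  These agree, because 1/2 + s and 1/2 + (-s - 1) are negatives of each other, and so they
  cancel.\<close>

lemma odd_gauss_sum_add_one:
  assumes "a > 0"
  shows "odd_gauss_sum a (s + 1) = - odd_gauss_sum a s"
proof -
  have "(1/2 + (- s - 1))\<^sup>2 = (1/2 + s)\<^sup>2"
    by (simp add: power2_eq_square algebra_simps)
  moreover have "- (s + 1) = - s - 1"
    by simp
  ultimately show ?thesis
    using alt_gauss_sum_shift[OF assms, of s] alt_gauss_sum_shift[OF assms, of "- s - 1"]
    unfolding odd_gauss_sum_def by simp
qed

lemma odd_gauss_sum_add_int_eq_0_iff:
  assumes "a > 0"
  shows "odd_gauss_sum a (s + of_int k) = 0 \<longleftrightarrow> odd_gauss_sum a s = 0"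
proof (induction k rule: int_induct[where k = 0])
  case base
  then show ?case by simp
next
  case (step1 i)
  then show ?case
    using odd_gauss_sum_add_one[OF assms, of "s + of_int i"] by (simp add: algebra_simps)
next
  case (step2 i)
  then show ?case
    using odd_gauss_sum_add_one[OF assms, of "s + of_int (i - 1)"] by (simp add: algebra_simps)
qed

section \<open>Positivity between consecutive integers\<close>

text \<open>This bounds the growth of the sinh factors by the decay of the Gaussian weights, which
  is what makes the alternating series for \<open>odd_gauss_sum\<close> strictly decreasing in
  absolute value.\<close>

lemma sinh_odd_ratio_less:
  fixes a t :: real
  assumes "a \<ge> 1" and "0 < t" "t \<le> a / 2"
  shows "sinh ((2 * real n + 3) * t) < exp (2 * a * (real n + 1)) * sinh ((2 * real n + 1) * t)"
proof -
  define m where "m = 2 * real n + 1"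
  \<comment> \<open>Since m \<ge> 1, this says tanh t \<le> tanh (m t), which controls the cosh (m
    t) term in the expansion of sinh (m t + 2 t).\<close>
  have "0 \<le> sinh (m * t - t)"
    using assms by (simp add: m_def algebra_simps)
  then have "sinh t * cosh (m * t) \<le> sinh (m * t) * cosh t"
    by (simp add: sinh_diff algebra_simps)
  then have "2 * cosh t * (sinh t * cosh (m * t)) \<le> 2 * cosh t * (sinh (m * t) * cosh t)"
    by (intro mult_left_mono) auto
  then have "cosh (m * t) * sinh (2 * t) \<le> (2 * (cosh t)\<^sup>2) * sinh (m * t)"
    unfolding sinh_double by (simp add: power2_eq_square algebra_simps)
  moreover have "2 * (cosh t)\<^sup>2 = 1 + cosh (2 * t)"
    by (simp add: cosh_double cosh_square_eq)
  ultimately have "sinh (m * t + 2 * t) \<le> (1 + 2 * cosh (2 * t)) * sinh (m * t)"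
    by (simp add: sinh_add algebra_simps)
  also have "\<dots> < exp (2 * a * (real n + 1)) * sinh (m * t)"
  proof (rule mult_strict_right_mono)
    \<comment> \<open>With e^a \<ge> 2 one gets 1 + 2 cosh a \<le> e^a + 3/2 < 2 e^a \<le> e^(2a);
      this is where a \<ge> 1 enters.\<close>
    have "cosh (2 * t) \<le> cosh a"
      using assms by (subst cosh_real_nonneg_le_iff) auto
    moreover have "2 * cosh a = exp a + exp (- a)"
      by (simp add: cosh_field_def)
    moreover have u: "exp a \<ge> 2"
      using exp_ge_add_one_self[of a] assms by linarith
    moreover have "exp (- a) \<le> 1/2"
      using u by (simp add: exp_minus field_simps)
    moreover have "2 * exp a \<le> exp (2 * a)"
      using mult_right_mono[OF u, of "exp a"] by (simp flip: exp_add)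
    moreover have "exp (2 * a) \<le> exp (2 * a * (real n + 1))"
      using assms by simp
    ultimately show "1 + 2 * cosh (2 * t) < exp (2 * a * (real n + 1))"
      by linarith
    show "0 < sinh (m * t)"
      using assms by (simp add: m_def)
  qed
  finally show ?thesis
    by (simp add: m_def algebra_simps)
qed

lemma gauss_mult_exp:
  "gauss a s n = exp (- a * s\<^sup>2) * (exp (- a * (real n + 1/2)\<^sup>2) * exp (- (2 * real n + 1) * (a * s)))"
  by (simp add: gauss_def power2_eq_square algebra_simps flip: exp_add)

lemma gauss_diff_eq_sinh:
  "gauss a (- s) n - gauss a s n =
     2 * exp (- a * s\<^sup>2) * (exp (- a * (real n + 1/2)\<^sup>2) * sinh ((2 * real n + 1) * (a * s)))"
  by (simp add: gauss_mult_exp sinh_field_def algebra_simps)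

lemma gauss_add_eq_cosh:
  "gauss a (- s) n + gauss a s n =
     2 * exp (- a * s\<^sup>2) * (exp (- a * (real n + 1/2)\<^sup>2) * cosh ((2 * real n + 1) * (a * s)))"
  by (simp add: gauss_mult_exp cosh_field_def algebra_simps)

text \<open>Pairing the terms at -s and s and factoring out exp(-a s^2) leaves, up to constants, the
  series of \<open>theta1\<close> at the imaginary point with ordinate a s.\<close>

lemma gauss_sinh_series:
  assumes "a > 0"
  shows "summable (\<lambda>n. (-1) ^ n * (exp (- a * (real n + 1/2)\<^sup>2) * sinh ((2 * real n + 1) * (a * s))))"
    and "odd_gauss_sum a s = 2 * exp (- a * s\<^sup>2) *
      (\<Sum>n. (-1) ^ n * (exp (- a * (real n + 1/2)\<^sup>2) * sinh ((2 * real n + 1) * (a * s))))"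
proof -
  define c where "c = 2 * exp (- a * s\<^sup>2)"
  define f where
    "f n = (-1) ^ n * (exp (- a * (real n + 1/2)\<^sup>2) * sinh ((2 * real n + 1) * (a * s)))" for n
  have c: "c \<noteq> 0"
    by (simp add: c_def)
  have eq: "(-1) ^ n * gauss a (- s) n - (-1) ^ n * gauss a s n = c * f n" for n
    unfolding right_diff_distrib[symmetric] gauss_diff_eq_sinh by (simp add: f_def c_def)
  have sums: "(\<lambda>n. (-1) ^ n * gauss a (- s) n - (-1) ^ n * gauss a s n) sums odd_gauss_sum a s"
    unfolding odd_gauss_sum_def alt_gauss_sum_def
    by (intro sums_diff summable_sums summable_alt_gauss assms)
  then have sums': "(\<lambda>n. c * f n) sums odd_gauss_sum a s"
    by (simp only: eq)
  then have "summable f"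
    using c sums_summable summable_mult_D by blast
  then show "summable (\<lambda>n. (-1) ^ n * (exp (- a * (real n + 1/2)\<^sup>2) * sinh ((2 * real n + 1) * (a * s))))"
    by (simp only: f_def[abs_def])
  have "odd_gauss_sum a s = c * suminf f"
    using sums' \<open>summable f\<close> sums_unique suminf_mult by metis
  then show "odd_gauss_sum a s = 2 * exp (- a * s\<^sup>2) *
      (\<Sum>n. (-1) ^ n * (exp (- a * (real n + 1/2)\<^sup>2) * sinh ((2 * real n + 1) * (a * s))))"
    by (simp only: f_def[abs_def] c_def)
qed

lemma summable_gauss_cosh:
  assumes "a > 0"
  shows "summable (\<lambda>n. exp (- a * (real n + 1/2)\<^sup>2) * cosh ((2 * real n + 1) * (a * s)))"
proof -
  have "summable (\<lambda>n. 2 * exp (- a * s\<^sup>2) *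
      (exp (- a * (real n + 1/2)\<^sup>2) * cosh ((2 * real n + 1) * (a * s))))"
    unfolding gauss_add_eq_cosh[symmetric]
    by (intro summable_add summable_gauss assms)
  then show ?thesis
    by (rule summable_mult_D) simp
qed

lemma odd_gauss_sum_pos_half:
  assumes "a \<ge> 1" and "0 < s" "s \<le> 1/2"
  shows "odd_gauss_sum a s > 0"
proof -
  define d where "d n = exp (- a * (real n + 1/2)\<^sup>2) * sinh ((2 * real n + 1) * (a * s))" for n
  have a: "a > 0" and t: "0 < a * s" "a * s \<le> a / 2"
    using assms mult_left_mono[of s "1/2" a] by auto
  have dec: "d (Suc n) < d n" for n
  proof -
    have "d (Suc n) = exp (- a * (real n + 3/2)\<^sup>2) * sinh ((2 * real n + 3) * (a * s))"
      by (simp add: d_def algebra_simps)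
    also have "\<dots> < exp (- a * (real n + 3/2)\<^sup>2) *
        (exp (2 * a * (real n + 1)) * sinh ((2 * real n + 1) * (a * s)))"
      using sinh_odd_ratio_less[OF assms(1) t] by (intro mult_strict_left_mono) auto
    also have "\<dots> = (exp (- a * (real n + 3/2)\<^sup>2) * exp (2 * a * (real n + 1))) *
        sinh ((2 * real n + 1) * (a * s))"
      by (simp only: mult.assoc)
    \<comment> \<open>The squares (n + 3/2)^2 and (n + 1/2)^2 differ by exactly 2 (n + 1).\<close>
    also have "exp (- a * (real n + 3/2)\<^sup>2) * exp (2 * a * (real n + 1)) =
        exp (- a * (real n + 1/2)\<^sup>2)"
      by (simp add: power2_eq_square algebra_simps flip: exp_add)
    finally show ?thesis
      by (simp only: d_def)
  qed
  have "summable (\<lambda>n. (-1) ^ n * d n)"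
    unfolding d_def by (rule gauss_sinh_series(1)[OF a])
  then have "(\<lambda>n. (-1) ^ n * d n) \<longlonglongrightarrow> 0"
    by (rule summable_LIMSEQ_zero)
  then have "(\<lambda>n. norm ((-1) ^ n * d n)) \<longlonglongrightarrow> 0"
    by (rule tendsto_norm_zero)
  then have lim: "d \<longlonglongrightarrow> 0"
    by (simp add: abs_mult power_abs tendsto_rabs_zero_iff)
  have mono: "monoseq d"
    using dec by (intro decseq_imp_monoseq decseq_SucI less_imp_le)
  have "0 < d 0"
    using t by (simp add: d_def)
  \<comment> \<open>By the Leibniz criterion every partial sum of even length bounds the series from
    below; two terms already give a positive bound.\<close>
  then have "(\<Sum>i<2 * 1. (-1) ^ i * d i) \<le> (\<Sum>i. (-1) ^ i * d i)"
    using summable_Leibniz(2)[OF lim mono] by (meson atLeastAtMost_iff)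
  moreover have "(\<Sum>i<2 * 1. (-1) ^ i * d i) = d 0 - d (Suc 0)"
    by (simp add: numeral_2_eq_2)
  ultimately have "0 < (\<Sum>i. (-1) ^ i * d i)"
    using dec[of 0] by linarith
  then show ?thesis
    unfolding gauss_sinh_series(2)[OF a] d_def by (intro mult_pos_pos) auto
qed

text \<open>Oddness and the sign change under unit shifts combine to symmetry under s \<mapsto> 1 -
  s, which carries (1/2, 1) into (0, 1/2).\<close>

lemma odd_gauss_sum_pos:
  assumes "a \<ge> 1" and "0 < s" "s < 1"
  shows "odd_gauss_sum a s > 0"
proof (cases "s \<le> 1/2")
  case True
  then show ?thesis
    using odd_gauss_sum_pos_half assms by blast
next
  case False
  then have "0 < odd_gauss_sum a (1 - s)"
    using odd_gauss_sum_pos_half assms by simp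
  also have "odd_gauss_sum a (1 - s) = odd_gauss_sum a s"
    using odd_gauss_sum_add_one[of a "- s"] odd_gauss_sum_minus[of a s] assms by simp
  finally show ?thesis .
qed

lemma odd_gauss_sum_eq_0_iff:
  assumes "a \<ge> 1"
  shows "odd_gauss_sum a s = 0 \<longleftrightarrow> s \<in> \<int>"
proof -
  have "odd_gauss_sum a s = 0 \<longleftrightarrow> odd_gauss_sum a (frac s) = 0"
    using odd_gauss_sum_add_int_eq_0_iff[of a "frac s" "\<lfloor>s\<rfloor>"] assms
    by (simp add: frac_def)
  also have "\<dots> \<longleftrightarrow> frac s = 0"
  proof
    assume "odd_gauss_sum a (frac s) = 0"
    then show "frac s = 0"
      using odd_gauss_sum_pos[OF assms, of "frac s"] frac_ge_0[of s] frac_lt_1[of s]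
      by fastforce
  next
    assume "frac s = 0"
    moreover have "odd_gauss_sum a 0 = 0"
      by (simp add: odd_gauss_sum_def)
    ultimately show "odd_gauss_sum a (frac s) = 0"
      by metis
  qed
  finally show ?thesis
    by (simp add: frac_eq_0_iff)
qed

section \<open>Theta functions on the imaginary axis\<close>

lemma theta1_imaginary:
  assumes "a > 0"
  shows "theta1 (\<i> * of_real (a * s)) (exp (- a)) = \<i> * of_real (exp (a * s\<^sup>2) * odd_gauss_sum a s)"
proof -
  define f where
    "f n = (-1) ^ n * (exp (- a * (real n + 1/2)\<^sup>2) * sinh ((2 * real n + 1) * (a * s)))" for n
  have sin_i: "sin (\<i> * of_real x) = \<i> * of_real (sinh x)" for x
    by (simp add: sin_i_times sinh_field_def exp_minus flip: exp_of_real)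
  have "(-1) ^ n * of_real (exp (- a) powr ((real n + 1/2)\<^sup>2)) *
      sin (of_nat (2 * n + 1) * (\<i> * of_real (a * s))) = \<i> * complex_of_real (f n)" for n
  proof -
    have "of_nat (2 * n + 1) * (\<i> * complex_of_real (a * s)) =
        \<i> * of_real ((2 * real n + 1) * (a * s))"
      by simp
    then show ?thesis
      unfolding f_def by (simp only: sin_i exp_powr_real) simp
  qed
  then have "theta1 (\<i> * of_real (a * s)) (exp (- a)) = 2 * (\<Sum>n. \<i> * complex_of_real (f n))"
    by (simp only: theta1_def)
  also have f: "summable f"
    unfolding f_def by (rule gauss_sinh_series(1)[OF assms])
  then have "(\<lambda>n. \<i> * complex_of_real (f n)) sums (\<i> * of_real (suminf f))"
    by (intro sums_mult sums_of_real summable_sums)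
  then have "(\<Sum>n. \<i> * complex_of_real (f n)) = \<i> * of_real (suminf f)"
    by (rule sums_unique[symmetric])
  also have "2 * (\<i> * complex_of_real (suminf f)) = \<i> * of_real (2 * suminf f)"
    by simp
  also have "2 * suminf f = exp (a * s\<^sup>2) * odd_gauss_sum a s"
    unfolding gauss_sinh_series(2)[OF assms] f_def by (simp add: exp_minus)
  finally show ?thesis .
qed

lemma theta1_imaginary_eq_0_iff:
  assumes "a \<ge> 1"
  shows "theta1 (\<i> * of_real t) (exp (- a)) = 0 \<longleftrightarrow> t / a \<in> \<int>"
  using theta1_imaginary[of a "t / a"] odd_gauss_sum_eq_0_iff[OF assms, of "t / a"] assms by simp

text \<open>On the imaginary axis each cosine becomes a cosh, so all terms of the series are
  positive reals.\<close>

lemma theta2_imaginary_neq_0: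
  assumes "a > 0"
  shows "theta2 (\<i> * of_real t) (exp (- a)) \<noteq> 0"
proof -
  define f where "f n = exp (- a * (real n + 1/2)\<^sup>2) * cosh ((2 * real n + 1) * t)" for n
  have cos_i: "cos (\<i> * of_real x) = of_real (cosh x)" for x
    by (simp add: cos_i_times cosh_field_def exp_minus flip: exp_of_real)
  have "of_real (exp (- a) powr ((real n + 1/2)\<^sup>2)) *
      cos (of_nat (2 * n + 1) * (\<i> * of_real t)) = complex_of_real (f n)" for n
  proof -
    have "of_nat (2 * n + 1) * (\<i> * complex_of_real t) = \<i> * of_real ((2 * real n + 1) * t)"
      by simp
    then show ?thesis
      unfolding f_def by (simp only: cos_i exp_powr_real) simp
  qed
  then have "theta2 (\<i> * of_real t) (exp (- a)) = 2 * (\<Sum>n. complex_of_real (f n))"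
    by (simp only: theta2_def)
  moreover have f: "summable f"
    using summable_gauss_cosh[OF assms, of "t / a"] assms by (simp add: f_def[abs_def])
  moreover have "suminf f > 0"
    using f by (rule suminf_pos) (simp add: f_def)
  ultimately show ?thesis
    by (simp flip: suminf_of_real)
qed

section \<open>Transfer to the lines with real part \<plusminus>pi/2 by shift and parity\<close>

lemma sin_odd_mult_add_half_pi:
  "sin (of_nat (2 * n + 1) * (z + of_real (pi / 2))) = (-1) ^ n * cos (of_nat (2 * n + 1) * z :: complex)"
proof -
  have "of_nat (2 * n + 1) * (z + of_real (pi / 2)) =
      of_nat (2 * n + 1) * z + of_real pi / 2 + of_nat n * of_real pi"
    by (simp add: field_simps)
  then show ?thesis
    by (simp only: sin_add cos_add sin_npi_complex' cos_npi_complex') simp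
qed

lemma theta1_add_half_pi: "theta1 (z + of_real (pi / 2)) q = theta2 z q"
proof -
  have "(-1) ^ n * r * sin (of_nat (2 * n + 1) * (z + of_real (pi / 2))) =
      r * cos (of_nat (2 * n + 1) * z)" for n and r :: complex
    unfolding sin_odd_mult_add_half_pi by (simp flip: power_mult_distrib)
  then show ?thesis
    by (simp only: theta1_def theta2_def)
qed

lemma norm_sin_le_exp:
  fixes z :: complex
  shows "cmod (sin z) \<le> exp (cmod z)"
proof -
  have "cmod (sin z) = cmod (exp (\<i> * z) - exp (- (\<i> * z))) / 2"
    by (simp add: sin_exp_eq norm_divide norm_mult)
  also have "\<dots> \<le> (cmod (exp (\<i> * z)) + cmod (exp (- (\<i> * z)))) / 2"
    by (intro divide_right_mono norm_triangle_ineq4) simp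
  also have "\<dots> \<le> (exp (cmod z) + exp (cmod z)) / 2"
    using norm_exp[of "\<i> * z"] norm_exp[of "- (\<i> * z)"]
    by (intro divide_right_mono add_mono) (simp_all add: norm_mult)
  finally show ?thesis
    by simp
qed

text \<open>Convergence at every complex z allows the sign to be pulled out of the infinite sum when
  proving that \<open>theta1\<close> is odd. The majorant comes from |sin w| \<le> exp |w| \<le> 2
  cosh |w|.\<close>

lemma summable_theta1:
  fixes z :: complex
  assumes "a > 0"
  shows "summable (\<lambda>n. (-1) ^ n * of_real (exp (- a) powr ((real n + 1/2)\<^sup>2)) *
    sin (of_nat (2 * n + 1) * z))"
proof (rule summable_comparison_test')
  show "summable (\<lambda>n. 2 * (exp (- a * (real n + 1/2)\<^sup>2) * cosh ((2 * real n + 1) * cmod z)))"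
    using summable_gauss_cosh[OF assms, of "cmod z / a"] assms by (intro summable_mult) simp
  fix n :: nat
  have "cmod (sin (of_nat (2 * n + 1) * z)) \<le> exp (cmod (of_nat (2 * n + 1) * z))"
    by (rule norm_sin_le_exp)
  also have "cmod (of_nat (2 * n + 1) * z) = (2 * real n + 1) * cmod z"
    unfolding norm_mult norm_of_nat by simp
  also have "exp ((2 * real n + 1) * cmod z) \<le> 2 * cosh ((2 * real n + 1) * cmod z)"
    by (simp add: cosh_field_def)
  finally have *: "cmod (sin (of_nat (2 * n + 1) * z)) \<le> 2 * cosh ((2 * real n + 1) * cmod z)" .
  have "norm ((-1) ^ n * of_real (exp (- a) powr ((real n + 1/2)\<^sup>2)) * sin (of_nat (2 * n + 1) * z))
      = exp (- a * (real n + 1/2)\<^sup>2) * cmod (sin (of_nat (2 * n + 1) * z))"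
    by (simp only: exp_powr_real norm_mult norm_power norm_minus_cancel norm_one power_one
        mult_1_left norm_of_real abs_exp_cancel)
  also have "\<dots> \<le> exp (- a * (real n + 1/2)\<^sup>2) * (2 * cosh ((2 * real n + 1) * cmod z))"
    using * by (intro mult_left_mono) auto
  finally show "norm ((-1) ^ n * of_real (exp (- a) powr ((real n + 1/2)\<^sup>2)) *
      sin (of_nat (2 * n + 1) * z)) \<le>
      2 * (exp (- a * (real n + 1/2)\<^sup>2) * cosh ((2 * real n + 1) * cmod z))"
    by (simp only: mult.left_commute)
qed

lemma theta1_minus:
  assumes "a > 0"
  shows "theta1 (- z) (exp (- a)) = - theta1 z (exp (- a))"
  unfolding theta1_def mult_minus_right sin_minus
  by (simp only: suminf_minus[OF summable_theta1[OF assms]] mult_minus_right)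

lemma theta2_minus: "theta2 (- z) q = theta2 z q"
  by (simp add: theta2_def)

text \<open>The shift turns \<open>theta1\<close> on the line at pi/2 into \<open>theta2\<close> on
  the imaginary axis, and oddness of \<open>theta1\<close> reflects this to the line at
  -pi/2.\<close>

lemma theta1_imaginary_add_half_pi_neq_0:
  assumes "a > 0" and "x = pi / 2 \<or> x = - (pi / 2)"
  shows "theta1 (of_real x + \<i> * of_real t) (exp (- a)) \<noteq> 0"
proof -
  have pos: "theta1 (of_real (pi / 2) + \<i> * of_real u) (exp (- a)) \<noteq> 0" for u
    using theta1_add_half_pi[of "\<i> * of_real u"] theta2_imaginary_neq_0[OF assms(1)]
    by (simp only: add.commute) simp
  have "theta1 (- (of_real (pi / 2) + \<i> * of_real (- t))) (exp (- a)) \<noteq> 0"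
    unfolding theta1_minus[OF assms(1)] using pos[of "- t"] by simp
  also have "- (of_real (pi / 2) + \<i> * of_real (- t)) = of_real (- (pi / 2)) + \<i> * of_real t"
    by simp
  finally show ?thesis
    using assms(2) pos[of t] by metis
qed

text \<open>Here the shift leads from the line at -pi/2 to \<open>theta1\<close> on the imaginary
  axis, and evenness of \<open>theta2\<close> gives the other line.\<close>

lemma theta2_imaginary_add_half_pi_eq_0_iff:
  assumes "a \<ge> 1" and "x = pi / 2 \<or> x = - (pi / 2)"
  shows "theta2 (of_real x + \<i> * of_real t) (exp (- a)) = 0 \<longleftrightarrow> t / a \<in> \<int>"
proof -
  have neg: "theta2 (of_real (- (pi / 2)) + \<i> * of_real u) (exp (- a)) = 0 \<longleftrightarrow> u / a \<in> \<int>" for u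
    using theta1_add_half_pi[of "of_real (- (pi / 2)) + \<i> * of_real u"]
      theta1_imaginary_eq_0_iff[OF assms(1), of u]
    by simp
  have "theta2 (- (of_real (- (pi / 2)) + \<i> * of_real (- t))) (exp (- a)) = 0 \<longleftrightarrow> t / a \<in> \<int>"
    unfolding theta2_minus neg by (simp add: minus_in_Ints_iff)
  also have "- (of_real (- (pi / 2)) + \<i> * of_real (- t)) = of_real (pi / 2) + \<i> * of_real t"
    by simp
  finally show ?thesis
    using assms(2) neg[of t] by metis
qed

section \<open>Singular points of the reduced Hamiltonian\<close>

theorem lemma5p2:
  fixes \<Gamma>1 \<Gamma>2 C :: real
  assumes "\<Gamma>1 > \<Gamma>2" and "\<Gamma>2 > 0"
  shows "(\<forall>y1. (0, y1) \<in> singular_points \<Gamma>1 \<Gamma>2 C \<longleftrightarrow>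
            (\<exists>k::int. y1 = (pi * of_int k * \<Gamma>2 + C) / (\<Gamma>1 + \<Gamma>2))) \<and>
         (\<forall>x \<in> {pi, - pi}. \<forall>y1. (x, y1) \<in> singular_points \<Gamma>1 \<Gamma>2 C \<longleftrightarrow>
            (\<exists>k::int. y1 = (of_int k * pi * \<Gamma>2 - C) / (\<Gamma>2 - \<Gamma>1)))"
proof -
  define a :: real where "a = pi / 2"
  have a: "a \<ge> 1" "a > 0"
    using pi_ge_two by (auto simp: a_def)
  have q: "exp (- pi / 2) = exp (- a)"
    by (simp add: a_def)
  have half: "(of_real x + \<i> * of_real y) / 2 = complex_of_real (x / 2) + \<i> * of_real (y / 2)" for x y
    by (simp add: field_simps)
  \<comment> \<open>The arguments of both self-interaction logarithms lie on the line with real part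
    -pi/2, where \<open>theta1\<close> has no zeros.\<close>
  have self: "theta1 (\<i> * of_real y - of_real (pi / 2)) (exp (- a)) \<noteq> 0" for y
    using theta1_imaginary_add_half_pi_neq_0[OF a(2), of "- (pi / 2)" y]
    by (simp add: algebra_simps)
  have Ints_iff: "y / 2 / a \<in> \<int> \<longleftrightarrow> (\<exists>k::int. y = of_int k * pi)" for y
    by (auto simp: a_def Ints_def field_simps)
  note sing = singular_points_iff q half
  show ?thesis
  proof (intro conjI allI ballI)
    fix y1
    define y2 where "y2 = vortex_y2 \<Gamma>1 \<Gamma>2 C y1"
    have "(0, y1) \<in> singular_points \<Gamma>1 \<Gamma>2 C \<longleftrightarrow> (y1 - y2) / 2 / a \<in> \<int>"
      using theta1_imaginary_eq_0_iff[OF a(1), of "(y1 - y2) / 2"]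
        theta2_imaginary_neq_0[OF a(2), of "(y1 + y2) / 2"] self
      unfolding sing y2_def[symmetric] by simp
    \<comment> \<open>Substituting \<open>y2\<close> makes y1 - y2 = k pi linear in
      \<open>y1\<close>, with coefficient (\<Gamma>1 + \<Gamma>2) / \<Gamma>2.\<close>
    also have "\<dots> \<longleftrightarrow> (\<exists>k::int. y1 = (pi * of_int k * \<Gamma>2 + C) / (\<Gamma>1 + \<Gamma>2))"
      unfolding Ints_iff y2_def vortex_y2_def using assms
      by (intro ex_cong1) (auto simp: field_simps)
    finally show "(0, y1) \<in> singular_points \<Gamma>1 \<Gamma>2 C \<longleftrightarrow>
        (\<exists>k::int. y1 = (pi * of_int k * \<Gamma>2 + C) / (\<Gamma>1 + \<Gamma>2))" .
  next
    fix x y1 :: real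
    assume "x \<in> {pi, - pi}"
    then have x: "x / 2 = pi / 2 \<or> x / 2 = - (pi / 2)"
      by auto
    define y2 where "y2 = vortex_y2 \<Gamma>1 \<Gamma>2 C y1"
    have "(x, y1) \<in> singular_points \<Gamma>1 \<Gamma>2 C \<longleftrightarrow> (y1 + y2) / 2 / a \<in> \<int>"
      using theta1_imaginary_add_half_pi_neq_0[OF a(2) x]
        theta2_imaginary_add_half_pi_eq_0_iff[OF a(1) x] self
      unfolding sing y2_def[symmetric] by blast
    \<comment> \<open>Now y1 + y2 = k pi has coefficient (\<Gamma>2 - \<Gamma>1) / \<Gamma>2, which
      is nonzero because the strengths differ.\<close>
    also have "\<dots> \<longleftrightarrow> (\<exists>k::int. y1 = (of_int k * pi * \<Gamma>2 - C) / (\<Gamma>2 - \<Gamma>1))"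
      unfolding Ints_iff y2_def vortex_y2_def using assms
      by (intro ex_cong1) (auto simp: field_simps)
    finally show "(x, y1) \<in> singular_points \<Gamma>1 \<Gamma>2 C \<longleftrightarrow>
        (\<exists>k::int. y1 = (of_int k * pi * \<Gamma>2 - C) / (\<Gamma>2 - \<Gamma>1))" .
  qed
qed

end
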